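(* Let $K=\mathbb{R}$ or $K=\mathbb{C}$, and let $\Gamma_3$ be a cubic curve in the projective plane $\mathbb{P}^2$ over $K$, defined by a nonzero homogeneous polynomial of degree $3$. Let $a,b,c$ be three lines with no common point, none of which is a component of $\Gamma_3$. Suppose that each of $a,b,c$ meets $\Gamma_3$ in three points of $\mathbb{P}^2$ counted with multiplicity, giving nine intersection points in all. Choose any six of these nine points such that no three of the chosen six are collinear (so exactly two of them are taken from each of the three lines), and label them $p_1,\dots,p_6$ so that $p_1,p_2\in a$, $p_3,p_4\in b$, $p_5,p_6\in c$. Let $p_7\in a$, $p_8\in b$, $p_9\in c$ be the remaining three intersection points. Then the three points $\Psi(p_1,\dots,p_6)$ determined by the Pascal mapping, together with the three points $p_7,p_8,p_9$, all lie on a conic.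
   Context: A conic is the zero set in $\mathbb{P}^2$ of a nonzero homogeneous quadratic polynomial over $K$ (possibly degenerate). For points $s\ne t$, $(s,t)$ denotes the line joining them; for lines $l\neq m$, $\langle l,m\rangle$ denotes their intersection point. Put $u=\langle a,c\rangle$, $v=\langle a,b\rangle$, $w=\langle b,c\rangle$, and fix one representative vector in $K^3$ for each of $u,v,w$, used throughout. Characteristic mapping: for two distinct points $s,t$ with fixed representative vectors and a point $p=\alpha s+\beta t$ on the line $(s,t)$ with $\alpha\beta\neq 0$, the characteristic mapping point $\chi_{(s,t)}(p)$ is the unique point $q=\alpha' s+\beta' t$ of the line $(s,t)$ with $\frac{\beta\beta'}{\alpha\alpha'}=1$, i.e. $\chi_{(s,t)}(p)=\beta s+\alpha t$. Pascal mapping: for the ordered six points $p_1,\dots,p_6$, no three collinear, with $a=(p_1,p_2)$, $b=(p_3,p_4)$, $c=(p_5,p_6)$, put $$q_1=\langle(p_1,p_2),(p_4,p_5)\rangle,\quad q_2=\langle(p_2,p_3),(p_5,p_6)\rangle,\quad q_3=\langle(p_3,p_4),(p_6,p_1)\rangle,$$ so that $q_1\in a=(u,v)$, $q_2\in c=(w,u)$, $q_3\in b=(v,w)$. The Pascal mapping is $$\Psi(p_1,\dots,p_6)=\{\chi_{(u,v)}(q_1),\ \chi_{(w,u)}(q_2),\ \chi_{(v,w)}(q_3)\}.$$ *)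

theory Defs
  imports
    "HOL-Analysis.Analysis"
    "HOL-Computational_Algebra.Polynomial"
    "HOL-Library.Multiset"
    "HOL-Library.Poly_Mapping"
begin

text \<open>
  A point (line) of the projective plane over a field is a one-dimensional (two-dimensional) linear
  subspace of the space of coordinate triples; incidence is inclusion.
\<close>

definition proj_point :: "('a::field ^ 3) set \<Rightarrow> bool" where
  "proj_point P \<longleftrightarrow> vec.subspace P \<and> vec.dim P = 1"

definition proj_line :: "('a::field ^ 3) set \<Rightarrow> bool" where
  "proj_line l \<longleftrightarrow> vec.subspace l \<and> vec.dim l = 2"

definition join :: "('a::field ^ 3) set \<Rightarrow> ('a ^ 3) set \<Rightarrow> ('a ^ 3) set" where
  "join P Q = vec.span (P \<union> Q)"

definition meet :: "('a::field ^ 3) set \<Rightarrow> ('a ^ 3) set \<Rightarrow> ('a ^ 3) set" where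
  "meet l m = l \<inter> m"

text \<open>A triple with a repeated point counts as collinear.\<close>

definition collinear3 :: "('a::field ^ 3) set \<Rightarrow> ('a ^ 3) set \<Rightarrow> ('a ^ 3) set \<Rightarrow> bool" where
  "collinear3 P Q R \<longleftrightarrow> (\<exists>l. proj_line l \<and> P \<subseteq> l \<and> Q \<subseteq> l \<and> R \<subseteq> l)"

text \<open>
  Polynomials in three variables: finitely supported maps from exponent vectors to coefficients,
  with the convolution product of \<^theory>\<open>HOL-Library.Poly_Mapping\<close>.
\<close>

type_synonym 'a poly3 = "(3 \<Rightarrow>\<^sub>0 nat) \<Rightarrow>\<^sub>0 'a"

definition homogeneous :: "nat \<Rightarrow> 'a::zero poly3 \<Rightarrow> bool" where
  "homogeneous d F \<longleftrightarrow>
     (\<forall>m \<in> Poly_Mapping.keys F. (\<Sum>i\<in>UNIV. Poly_Mapping.lookup m i) = d)"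

definition eval3 :: "'a::comm_semiring_1 poly3 \<Rightarrow> 'a ^ 3 \<Rightarrow> 'a" where
  "eval3 F x = (\<Sum>m \<in> Poly_Mapping.keys F.
     Poly_Mapping.lookup F m * (\<Prod>i\<in>UNIV. (x $ i) ^ Poly_Mapping.lookup m i))"

definition zero_set :: "'a::field poly3 \<Rightarrow> ('a ^ 3) set set" where
  "zero_set F = {P. proj_point P \<and> (\<forall>x\<in>P. eval3 F x = 0)}"

definition is_conic :: "('a::field ^ 3) set set \<Rightarrow> bool" where
  "is_conic C \<longleftrightarrow> (\<exists>Q. Q \<noteq> 0 \<and> homogeneous 2 Q \<and> C = zero_set Q)"

definition line_component :: "('a::field ^ 3) set \<Rightarrow> 'a poly3 \<Rightarrow> bool" where
  "line_component l F \<longleftrightarrow>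
     (\<exists>L. L \<noteq> 0 \<and> homogeneous 1 L \<and> l = {x. eval3 L x = 0} \<and> L dvd F)"

text \<open>The univariate polynomial $F(x + T y)$ in the indeterminate $T$.\<close>

definition line_restriction :: "'a::field poly3 \<Rightarrow> 'a ^ 3 \<Rightarrow> 'a ^ 3 \<Rightarrow> 'a poly" where
  "line_restriction F x y = (\<Sum>m \<in> Poly_Mapping.keys F.
     smult (Poly_Mapping.lookup F m) (\<Prod>i\<in>UNIV. [:x $ i, y $ i:] ^ Poly_Mapping.lookup m i))"

text \<open>
  The intersection multiplicity at \<open>P\<close> of the curve \<open>F = 0\<close> with a line \<open>l\<close> through \<open>P\<close> is the
  order of vanishing at $T = 0$ of $F(x + T y)$, where \<open>x\<close> represents \<open>P\<close> and \<open>x, y\<close> span \<open>l\<close>.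
  For homogeneous \<open>F\<close> not vanishing on \<open>l\<close> this does not depend on the choice of \<open>x\<close> and \<open>y\<close>.
\<close>

definition has_intersection_mult ::
    "'a::field poly3 \<Rightarrow> ('a ^ 3) set \<Rightarrow> ('a ^ 3) set \<Rightarrow> nat \<Rightarrow> bool" where
  "has_intersection_mult F l P n \<longleftrightarrow>
     (\<forall>x y. P = vec.span {x} \<and> l = vec.span {x, y} \<longrightarrow> order 0 (line_restriction F x y) = n)"

text \<open>\<open>M\<close> is the multiset of intersection points of \<open>l\<close> with \<open>F = 0\<close>, counted with multiplicity.\<close>

definition intersection_points ::
    "'a::field poly3 \<Rightarrow> ('a ^ 3) set \<Rightarrow> ('a ^ 3) set multiset \<Rightarrow> bool" where
  "intersection_points F l M \<longleftrightarrow>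
     (\<forall>P \<in># M. proj_point P \<and> P \<subseteq> l) \<and>
     (\<forall>P. proj_point P \<and> P \<subseteq> l \<longrightarrow> has_intersection_mult F l P (count M P))"

text \<open>
  The vectors \<open>s\<close> and \<open>t\<close> are the fixed representatives of the two base points. The quotient being
  \<open>1\<close> forces all four coefficients to be nonzero, as division by \<open>0\<close> yields \<open>0\<close>.
\<close>

definition characteristic_map ::
    "'a::field ^ 3 \<Rightarrow> 'a ^ 3 \<Rightarrow> ('a ^ 3) set \<Rightarrow> ('a ^ 3) set" where
  "characteristic_map s t P = (THE Q. \<exists>\<alpha> \<beta> \<alpha>' \<beta>'.
     \<alpha> * \<beta> \<noteq> 0 \<and> P = vec.span {\<alpha> *s s + \<beta> *s t} \<and>
     Q = vec.span {\<alpha>' *s s + \<beta>' *s t} \<and> (\<beta> * \<beta>') / (\<alpha> * \<alpha>') = 1)"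

text \<open>
  Here \<open>u, v, w\<close> are the fixed representatives of \<open>\<langle>a,c\<rangle>, \<langle>a,b\<rangle>, \<langle>b,c\<rangle>\<close> for \<open>a = (p\<^sub>1,p\<^sub>2)\<close>,
  \<open>b = (p\<^sub>3,p\<^sub>4)\<close>, \<open>c = (p\<^sub>5,p\<^sub>6)\<close>.
\<close>

definition pascal_map ::
    "'a::field ^ 3 \<Rightarrow> 'a ^ 3 \<Rightarrow> 'a ^ 3 \<Rightarrow> (nat \<Rightarrow> ('a ^ 3) set) \<Rightarrow> ('a ^ 3) set set" where
  "pascal_map u v w p =
    (let q1 = meet (join (p 1) (p 2)) (join (p 4) (p 5));
         q2 = meet (join (p 2) (p 3)) (join (p 5) (p 6));
         q3 = meet (join (p 3) (p 4)) (join (p 6) (p 1))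
     in {characteristic_map u v q1, characteristic_map w u q2, characteristic_map v w q3})"

end

theory Submission imports Defs begin

text \<open>
  Take \<open>u, v, w\<close> as basis and orient the triangle cyclically, so that a point of the side
  \<open>(s, t)\<close> is \<open>\<alpha> s + \<beta> t\<close>. By Carnot's theorem for cubics, the nine intersection points satisfy
  \<open>\<Prod>\<alpha> = - \<Prod>\<beta>\<close>. The Pascal points are \<open>\<alpha>\<^sub>4\<alpha>\<^sub>5 u - \<beta>\<^sub>4\<beta>\<^sub>5 v\<close> and its cyclic analogues, so each of the six
  points \<open>p\<^sub>1, \<dots>, p\<^sub>6\<close> contributes exactly once to their product, and the three sign changes turn
  Carnot's cubic relation for the nine points into the relation \<open>\<Prod>\<alpha> = \<Prod>\<beta>\<close> for the Pascal points together
  with \<open>p\<^sub>7, p\<^sub>8, p\<^sub>9\<close>. By the converse of Carnot's theorem, that relation suffices for a conic through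
  two points on each side.
\<close>

section \<open>Restriction of a form to a line\<close>

lemma poly_line_restriction: "poly (line_restriction F x y) t = eval3 F (x + t *s y)"
  by (simp add: line_restriction_def eval3_def poly_sum poly_prod poly_power)

lemma eval3_scale:
  assumes "homogeneous d F"
  shows "eval3 F (k *s x) = k ^ d * eval3 F x"
proof -
  have "Poly_Mapping.lookup F m * (\<Prod>i\<in>UNIV. ((k *s x) $ i) ^ Poly_Mapping.lookup m i)
      = k ^ d * (Poly_Mapping.lookup F m * (\<Prod>i\<in>UNIV. (x $ i) ^ Poly_Mapping.lookup m i))"
    if "m \<in> Poly_Mapping.keys F" for m
  proof -
    have "(\<Sum>i\<in>UNIV. Poly_Mapping.lookup m i) = d"
      using assms that by (auto simp: homogeneous_def)
    then show ?thesis
      by (simp add: power_mult_distrib prod.distrib mult.left_commute flip: power_sum)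
  qed
  then show ?thesis
    by (simp add: eval3_def sum_distrib_left)
qed

text \<open>Each monomial of \<open>F\<close> becomes a product of \<open>d\<close> factors of
  degree at most 1. Equality can fail: the coefficient of \<open>T^d\<close> is the value of
  \<open>F\<close> at \<open>y\<close>, which may be 0.\<close>

lemma degree_line_restriction_le:
  assumes "homogeneous d F"
  shows "degree (line_restriction F x y) \<le> d"
  unfolding line_restriction_def
proof (rule degree_sum_le)
  fix m assume "m \<in> Poly_Mapping.keys F"
  then have d: "(\<Sum>i\<in>UNIV. Poly_Mapping.lookup m i) = d"
    using assms by (auto simp: homogeneous_def)
  have "degree (\<Prod>i\<in>UNIV. [:x $ i, y $ i:] ^ Poly_Mapping.lookup m i)
      \<le> (\<Sum>i\<in>UNIV. degree ([:x $ i, y $ i:] ^ Poly_Mapping.lookup m i))"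
    using degree_prod_sum_le[of UNIV "\<lambda>i. [:x $ i, y $ i:] ^ Poly_Mapping.lookup m i"] by (simp add: o_def)
  also have "\<dots> \<le> (\<Sum>i\<in>UNIV. Poly_Mapping.lookup m i)"
  proof (rule sum_mono)
    fix i
    have "degree ([:x $ i, y $ i:] ^ Poly_Mapping.lookup m i)
        \<le> degree [:x $ i, y $ i:] * Poly_Mapping.lookup m i"
      by (rule degree_power_le)
    also have "\<dots> \<le> 1 * Poly_Mapping.lookup m i"
      by (intro mult_right_mono) auto
    finally show "degree ([:x $ i, y $ i:] ^ Poly_Mapping.lookup m i) \<le> Poly_Mapping.lookup m i"
      by simp
  qed
  finally show "degree (smult (Poly_Mapping.lookup F m)
      (\<Prod>i\<in>UNIV. [:x $ i, y $ i:] ^ Poly_Mapping.lookup m i)) \<le> d"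
    unfolding d using degree_smult_le le_trans by blast
qed simp

text \<open>Both sides are \<open>F (x + (s + T) y)\<close>. Comparing values proves the identity of
  polynomials because a field of characteristic 0 is infinite.\<close>

lemma line_restriction_shift:
  fixes F :: "'a::field_char_0 poly3"
  shows "line_restriction F (x + s *s y) y = pcompose (line_restriction F x y) [:s, 1:]"
  unfolding poly_eq_poly_eq_iff[symmetric]
  by (rule ext) (simp add: poly_line_restriction poly_pcompose algebra_simps vec.scale_left_distrib)

lemma pcompose_power: "pcompose (p ^ n) q = pcompose p q ^ n"
  for p q :: "'a::comm_ring_1 poly"
  by (induction n) (simp_all add: pcompose_mult one_pCons pcompose_pCons)

text \<open>Substituting \<open>T + s\<close> for \<open>T\<close> turns \<open>(T - s)^n\<close>
  into \<open>T^n\<close>; the new cofactor is nonzero at 0 because the old one is nonzero at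
  \<open>s\<close>.\<close>

lemma order_pcompose_shift:
  fixes p :: "'a::idom poly"
  assumes "p \<noteq> 0"
  shows "order 0 (pcompose p [:s, 1:]) = order s p"
proof -
  obtain q where q: "p = [:- s, 1:] ^ order s p * q" "\<not> [:- s, 1:] dvd q"
    using order_decomp[OF assms] by blast
  have q0: "poly (pcompose q [:s, 1:]) 0 \<noteq> 0"
    using q(2) by (simp add: poly_pcompose poly_eq_0_iff_dvd)
  \<comment> \<open>The root 0 is written as \<open>- 0\<close> so that the power has the shape
    \<open>[:- a, 1:] ^ n\<close> of \<open>order_power_n_n\<close>.\<close>
  have "pcompose p [:s, 1:] = [:- 0, 1:] ^ order s p * pcompose q [:s, 1:]"
    by (subst q(1)) (simp add: pcompose_mult pcompose_power pcompose_pCons)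
  moreover have "pcompose q [:s, 1:] \<noteq> 0"
    using q0 by auto
  ultimately show ?thesis
    using q0 by (simp add: order_mult order_power_n_n order_0I del: power_0 minus_zero)
qed

text \<open>The listed roots are split off one at a time by the factor theorem; the degree bound
  leaves only a constant cofactor.\<close>

lemma poly_eq_linear_factors:
  fixes p :: "'a::idom poly"
  assumes "proots p = {#r, s, t#}" "degree p \<le> 3"
  obtains c where "p = smult c ([:-r, 1:] * [:-s, 1:] * [:-t, 1:])"
proof -
  have p0: "p \<noteq> 0"
    using assms(1) by auto
  have split: "\<exists>q'. q = [:-a, 1:] * q' \<and> q' \<noteq> 0 \<and> proots q' = M"
    if "proots q = add_mset a M" "q \<noteq> 0" for a M and q :: "'a poly"
  proof -
    have "poly q a = 0"
      using that set_count_proots[of q] by auto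
    then obtain q' where q': "q = [:-a, 1:] * q'"
      by (auto simp: poly_eq_0_iff_dvd)
    with that(2) have "q' \<noteq> 0" by auto
    moreover have "proots q = {#a#} + proots q'"
      unfolding q' using \<open>q' \<noteq> 0\<close> by (subst proots_mult) auto
    ultimately show ?thesis
      using q' that(1) by auto
  qed
  obtain q where q: "p = [:-r, 1:] * q" "q \<noteq> 0" "proots q = {#s, t#}"
    using split[OF assms(1) p0] by blast
  obtain q' where q': "q = [:-s, 1:] * q'" "q' \<noteq> 0" "proots q' = {#t#}"
    using split[OF q(3,2)] by blast
  obtain q'' where q'': "q' = [:-t, 1:] * q''" "q'' \<noteq> 0"
    using split[OF q'(3,2)] by blast
  have "degree p = 3 + degree q''"
    unfolding q(1) q'(1) q''(1) using q''(2)
    by (simp add: degree_mult_eq del: mult_pCons_left)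
  with assms(2) have "degree q'' = 0" by simp
  then obtain c where "q'' = [:c:]"
    by (meson degree_eq_zeroE)
  then show ?thesis
    using that[of c] q(1) q'(1) q''(1) by (simp add: algebra_simps)
qed

section \<open>Points and lines in coordinates\<close>

text \<open>A condition on the pair rather than on the set \<open>{x, y}\<close>: a repeated vector
  is dependent here, although a singleton set can be independent.\<close>

definition lin_indep2 :: "'a::field ^ 3 \<Rightarrow> 'a ^ 3 \<Rightarrow> bool" where
  "lin_indep2 x y \<longleftrightarrow> (\<forall>\<alpha> \<beta>. \<alpha> *s x + \<beta> *s y = 0 \<longrightarrow> \<alpha> = 0 \<and> \<beta> = 0)"

lemma lin_indep2_commute: "lin_indep2 x y \<longleftrightarrow> lin_indep2 y x"
  unfolding lin_indep2_def by (metis add.commute)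

lemma lin_indep2D: "lin_indep2 x y \<Longrightarrow> \<alpha> *s x + \<beta> *s y = 0 \<longleftrightarrow> \<alpha> = 0 \<and> \<beta> = 0"
  unfolding lin_indep2_def by auto

lemma lin_indep2_eq_iff:
  assumes "lin_indep2 x y"
  shows "\<alpha> *s x + \<beta> *s y = \<gamma> *s x + \<delta> *s y \<longleftrightarrow> \<alpha> = \<gamma> \<and> \<beta> = \<delta>"
proof -
  have "\<alpha> *s x + \<beta> *s y = \<gamma> *s x + \<delta> *s y \<longleftrightarrow> (\<alpha> - \<gamma>) *s x + (\<beta> - \<delta>) *s y = 0"
    by (simp add: vec.scale_left_diff_distrib algebra_simps)
  then show ?thesis
    unfolding lin_indep2D[OF assms] by simp
qed

lemma span_pair_eq: "vec.span {x, y} = {\<alpha> *s x + \<beta> *s y |\<alpha> \<beta>. True}" for x y :: "'a::field ^ 3"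
proof (intro subset_antisym subsetI)
  fix z assume "z \<in> vec.span {x, y}"
  then obtain k m where "z - k *s x = m *s y"
    by (auto simp: vec.span_breakdown_eq vec.span_singleton)
  then have "z = k *s x + m *s y" by (simp add: algebra_simps)
  then show "z \<in> {\<alpha> *s x + \<beta> *s y |\<alpha> \<beta>. True}" by blast
qed (auto intro!: vec.span_add vec.span_scale intro: vec.span_base)

lemma span_singleton_eq_iff:
  fixes x y :: "'a::field ^ 3"
  assumes "x \<noteq> 0"
  shows "vec.span {x} = vec.span {y} \<longleftrightarrow> (\<exists>k. k \<noteq> 0 \<and> y = k *s x)"
proof
  assume eq: "vec.span {x} = vec.span {y}"
  then obtain k where k: "y = k *s x"
    using vec.span_base[of y "{y}"] by (auto simp: vec.span_singleton)
  have "x \<in> vec.span {y}"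
    using eq vec.span_base[of x "{x}"] by auto
  then have "k \<noteq> 0"
    using k assms by (auto simp: vec.span_singleton)
  with k show "\<exists>k. k \<noteq> 0 \<and> y = k *s x" by blast
next
  assume "\<exists>k. k \<noteq> 0 \<and> y = k *s x"
  then obtain k where k: "k \<noteq> 0" "y = k *s x" by blast
  then have "x = inverse k *s y" by simp
  then show "vec.span {x} = vec.span {y}"
    using k vec.span_scale[OF vec.span_base, of x "{x}"] vec.span_scale[OF vec.span_base, of y "{y}"]
    by (intro vec.span_eq[THEN iffD2]) (metis empty_subsetI insert_subset singletonI)
qed

text \<open>The coefficient pairs are homogeneous coordinates on the line through \<open>x\<close>
  and \<open>y\<close>. Two nonzero pairs are proportional exactly when their determinant
  vanishes.\<close>

lemma span_singleton_comb_eq_iff: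
  assumes "lin_indep2 x y" "\<alpha> \<noteq> 0 \<or> \<beta> \<noteq> 0" "\<gamma> \<noteq> 0 \<or> \<delta> \<noteq> 0"
  shows "vec.span {\<alpha> *s x + \<beta> *s y} = vec.span {\<gamma> *s x + \<delta> *s y} \<longleftrightarrow> \<alpha> * \<delta> = \<beta> * \<gamma>"
proof -
  have "vec.span {\<alpha> *s x + \<beta> *s y} = vec.span {\<gamma> *s x + \<delta> *s y} \<longleftrightarrow>
      (\<exists>k. k \<noteq> 0 \<and> \<gamma> *s x + \<delta> *s y = (k * \<alpha>) *s x + (k * \<beta>) *s y)"
    using assms(2) by (subst span_singleton_eq_iff)
      (auto simp: lin_indep2D[OF assms(1)] vec.scale_right_distrib)
  also have "\<dots> \<longleftrightarrow> (\<exists>k. k \<noteq> 0 \<and> \<gamma> = k * \<alpha> \<and> \<delta> = k * \<beta>)"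
    by (simp add: lin_indep2_eq_iff[OF assms(1)])
  also have "\<dots> \<longleftrightarrow> \<alpha> * \<delta> = \<beta> * \<gamma>"
  proof
    assume eq: "\<alpha> * \<delta> = \<beta> * \<gamma>"
    show "\<exists>k. k \<noteq> 0 \<and> \<gamma> = k * \<alpha> \<and> \<delta> = k * \<beta>"
    proof (cases "\<alpha> = 0")
      case True
      then show ?thesis using eq assms(2,3) by (intro exI[of _ "\<delta> / \<beta>"]) auto
    next
      case False
      then show ?thesis using eq assms(3) by (intro exI[of _ "\<gamma> / \<alpha>"]) (auto simp: field_simps)
    qed
  qed auto
  finally show ?thesis .
qed

text \<open>Cramer's rule: with \<open>D\<close> the determinant of the coefficients,
  \<open>D *s x\<close> and \<open>D *s y\<close> are combinations of the two new vectors.\<close>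

lemma span_pair_comb:
  fixes x y :: "'a::field ^ 3"
  assumes "\<alpha> * \<delta> \<noteq> \<beta> * \<gamma>"
  shows "vec.span {\<alpha> *s x + \<beta> *s y, \<gamma> *s x + \<delta> *s y} = vec.span {x, y}"
proof -
  define D where "D = \<alpha> * \<delta> - \<beta> * \<gamma>"
  have D: "D \<noteq> 0" using assms by (simp add: D_def)
  let ?p = "\<alpha> *s x + \<beta> *s y" and ?q = "\<gamma> *s x + \<delta> *s y"
  have "D *s x = \<delta> *s ?p - \<beta> *s ?q" "D *s y = \<alpha> *s ?q - \<gamma> *s ?p"
    by (simp_all add: vec_eq_iff D_def algebra_simps)
  then have "x = inverse D *s (\<delta> *s ?p - \<beta> *s ?q)" "y = inverse D *s (\<alpha> *s ?q - \<gamma> *s ?p)"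
    using D by (metis vec.scale_scale left_inverse vec.scale_one)+
  moreover have "inverse D *s (\<delta> *s ?p - \<beta> *s ?q) \<in> vec.span {?p, ?q}"
      "inverse D *s (\<alpha> *s ?q - \<gamma> *s ?p) \<in> vec.span {?p, ?q}"
    by (intro vec.span_scale vec.span_diff vec.span_base; simp)+
  moreover have "?p \<in> vec.span {x, y}" "?q \<in> vec.span {x, y}"
    by (auto intro!: vec.span_scale vec.span_add intro: vec.span_base)
  ultimately show ?thesis
    by (intro vec.span_eq[THEN iffD2]) auto
qed

lemma proj_point_span: "x \<noteq> 0 \<Longrightarrow> proj_point (vec.span {x})" for x :: "'a::field ^ 3"
  by (simp add: proj_point_def vec.dim_singleton)

lemma proj_pointE:
  assumes "proj_point P"
  obtains x where "x \<noteq> 0" "P = vec.span {x}"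
proof -
  obtain B where B: "B \<subseteq> P" "vec.independent B" "P \<subseteq> vec.span B" "card B = vec.dim P"
    using vec.basis_exists[of P] by blast
  then obtain x where "B = {x}"
    using assms by (auto simp: proj_point_def card_1_singleton_iff)
  moreover have "P = vec.span B"
    using B assms by (metis proj_point_def vec.span_subspace)
  moreover have "x \<noteq> 0"
    using B(2) calculation by auto
  ultimately show ?thesis using that by blast
qed

lemma proj_line_span:
  assumes "lin_indep2 x y"
  shows "proj_line (vec.span {x, y})"
proof -
  have "y \<noteq> 0" using lin_indep2D[OF assms, of 0 1] by auto
  moreover have "x \<notin> vec.span {y}"
    using lin_indep2D[OF assms, of 1] by (auto simp: vec.span_singleton) (metis add.right_inverse vec.scale_minus_left vec.scale_one one_neq_zero)
  ultimately show ?thesis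
    by (simp add: proj_line_def vec.dim_insert vec.dim_singleton)
qed

lemma proj_line_eq_span:
  assumes "proj_line l" "lin_indep2 x y" "x \<in> l" "y \<in> l"
  shows "l = vec.span {x, y}"
proof -
  have "vec.span {x, y} \<subseteq> l"
    using assms by (intro vec.span_minimal) (auto simp: proj_line_def)
  then show ?thesis
    using assms proj_line_span[OF assms(2)]
    by (metis order.refl proj_line_def vec.subspace_dim_equal)
qed

text \<open>By the dimension formula, two planes through the origin in a space of dimension 3
  intersect in dimension at least 1.\<close>

lemma proj_lines_meet:
  assumes "proj_line l" "proj_line m"
  obtains x where "x \<noteq> 0" "x \<in> l" "x \<in> m"
proof -
  let ?S = "{x + y |x y. x \<in> l \<and> y \<in> m}"
  have "vec.dim ?S + vec.dim (l \<inter> m) = 4"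
    using assms vec.dim_sums_Int[of l m] by (simp add: proj_line_def)
  moreover have "vec.dim ?S \<le> 3"
    using vec.dim_subset[of ?S UNIV] by (simp only: vec_dim_card) simp
  ultimately have "vec.dim (l \<inter> m) \<noteq> 0" by linarith
  then have "\<not> l \<inter> m \<subseteq> {0}" by (simp add: vec.dim_eq_0)
  then show ?thesis using that by blast
qed

section \<open>Carnot's theorem for cubics\<close>

text \<open>
  \<open>order 0 0\<close> is unspecified, but if the restriction vanished it would be the multiplicity at all of the
  infinitely many points \<open>x + s y\<close>, whereas \<open>M\<close> is finite and contains one of them.
\<close>

lemma line_restriction_nonzero:
  fixes F :: "'a::field_char_0 poly3"
  assumes M: "intersection_points F (vec.span {x, y}) M" and xy: "lin_indep2 x y"
    and t: "vec.span {x + t *s y} \<in># M"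
  shows "line_restriction F x y \<noteq> 0"
proof
  assume 0: "line_restriction F x y = 0"
  have count: "count M (vec.span {x + s *s y}) = order 0 (0 :: 'a poly)" for s
  proof -
    have "x + s *s y \<noteq> 0"
      using lin_indep2D[OF xy, of 1 s] by auto
    moreover have "x + s *s y \<in> vec.span {x, y}"
      by (auto intro!: vec.span_scale vec.span_add intro: vec.span_base)
    moreover have "vec.span {x, y} = vec.span {x + s *s y, y}"
      using span_pair_comb[of 1 1 s 0 x y] by simp
    moreover have "line_restriction F (x + s *s y) y = 0"
      by (simp add: line_restriction_shift 0)
    ultimately show ?thesis
      using M proj_point_span[of "x + s *s y"]
      unfolding intersection_points_def has_intersection_mult_def
      by (metis empty_subsetI insert_subset vec.span_minimal vec.subspace_span)
  qed
  have "vec.span {x + s *s y} \<in># M" for s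
    using t count[of t] count[of s] by (simp flip: count_greater_zero_iff)
  then have "range (\<lambda>s. vec.span {x + s *s y}) \<subseteq> set_mset M" by blast
  moreover have "inj (\<lambda>s. vec.span {x + s *s y})"
    using span_singleton_comb_eq_iff[OF xy, of 1 _ 1] by (auto simp: inj_def)
  ultimately show False
    using infinite_UNIV_char_0 finite_imageD finite_subset finite_set_mset by blast
qed

text \<open>Replacing the base point \<open>x\<close> by \<open>x + s *s y\<close> keeps the line
  and moves the root \<open>s\<close> to 0, where the multiplicity is defined. This covers every
  point of the line except that of \<open>y\<close>.\<close>

lemma count_intersection_points:
  fixes F :: "'a::field_char_0 poly3"
  assumes M: "intersection_points F (vec.span {x, y}) M" and xy: "lin_indep2 x y"
    and nz: "line_restriction F x y \<noteq> 0"
  shows "count M (vec.span {x + s *s y}) = order s (line_restriction F x y)"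
proof -
  have "x + s *s y \<noteq> 0"
    using lin_indep2D[OF xy, of 1 s] by auto
  moreover have "x + s *s y \<in> vec.span {x, y}"
    by (auto intro!: vec.span_scale vec.span_add intro: vec.span_base)
  moreover have "vec.span {x, y} = vec.span {x + s *s y, y}"
    using span_pair_comb[of 1 1 s 0 x y] by simp
  moreover have "order 0 (line_restriction F (x + s *s y) y) = order s (line_restriction F x y)"
    by (simp add: line_restriction_shift order_pcompose_shift nz)
  ultimately show ?thesis
    using M proj_point_span[of "x + s *s y"]
    unfolding intersection_points_def has_intersection_mult_def
    by (metis empty_subsetI insert_subset vec.span_minimal vec.subspace_span)
qed

text \<open>The member of \<open>M\<close> with parameter \<open>t\<close> guarantees a nonzero
  restriction; then \<open>F\<close> vanishes at \<open>x\<close> exactly when the restriction has 0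
  as a root.\<close>

lemma eval3_eq_0_iff:
  fixes F :: "'a::field_char_0 poly3"
  assumes M: "intersection_points F (vec.span {x, y}) M" and xy: "lin_indep2 x y"
    and t: "vec.span {x + t *s y} \<in># M"
  shows "eval3 F x = 0 \<longleftrightarrow> vec.span {x} \<in># M"
proof -
  note nz = line_restriction_nonzero[OF assms]
  have "eval3 F x = 0 \<longleftrightarrow> poly (line_restriction F x y) 0 = 0"
    by (simp add: poly_line_restriction)
  also have "\<dots> \<longleftrightarrow> order 0 (line_restriction F x y) \<noteq> 0"
    using nz by (simp add: order_root)
  also have "\<dots> \<longleftrightarrow> count M (vec.span {x}) \<noteq> 0"
    using count_intersection_points[OF M xy nz, of 0] by simp
  finally show ?thesis by simp
qed

text \<open>Vieta's formula for the product of the roots: the restriction is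
  \<open>c (T - r) (T - s) (T - t)\<close>, its constant term is \<open>F\<close> at
  \<open>x\<close>, and its coefficient \<open>c\<close> of \<open>T^3\<close> is \<open>F\<close>
  at \<open>y\<close>.\<close>

lemma eval3_ratio:
  fixes F :: "'a::field_char_0 poly3"
  assumes hom: "homogeneous 3 F" and xy: "lin_indep2 x y"
    and M: "intersection_points F (vec.span {x, y})
        {#vec.span {x + r *s y}, vec.span {x + s *s y}, vec.span {x + t *s y}#}"
  shows "eval3 F x = - (r * s * t * eval3 F y)"
proof -
  let ?f = "line_restriction F x y" and ?g = "line_restriction F y x"
  have nz: "?f \<noteq> 0"
    using line_restriction_nonzero[OF M xy, of r] by simp
  have inj: "vec.span {x + \<alpha> *s y} = vec.span {x + \<beta> *s y} \<longleftrightarrow> \<alpha> = \<beta>" for \<alpha> \<beta>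
    using span_singleton_comb_eq_iff[OF xy, of 1 \<alpha> 1 \<beta>] by auto
  \<comment> \<open>Distinct parameters give distinct points, so the multiplicities in the multiset
    of points are those of the parameters as roots.\<close>
  have "proots ?f = {#r, s, t#}"
    using nz by (intro multiset_eqI) (simp add: inj flip: count_intersection_points[OF M xy nz])
  then obtain c where c: "?f = smult c ([:-r, 1:] * [:-s, 1:] * [:-t, 1:])"
    using poly_eq_linear_factors degree_line_restriction_le[OF hom] by metis
  have f: "eval3 F (x + z *s y) = c * ((z - r) * (z - s) * (z - t))" for z
    unfolding poly_line_restriction[symmetric] c by (simp add: algebra_simps)
  \<comment> \<open>The reversal \<open>z^3 f (1/z)\<close> of \<open>?f\<close>. Homogeneity
    identifies it with the restriction \<open>?g\<close>, in which \<open>x\<close> and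
    \<open>y\<close> are exchanged, so that \<open>c\<close> becomes a value at 0.\<close>
  let ?h = "smult c ([:1, -r:] * [:1, -s:] * [:1, -t:])"
  have "poly ?g z = poly ?h z" if "z \<noteq> 0" for z
  proof -
    have "y + z *s x = z *s (x + inverse z *s y)"
      using that by (simp add: vec.scale_right_distrib)
    then have "poly ?g z = z ^ 3 * (c * ((inverse z - r) * (inverse z - s) * (inverse z - t)))"
      by (simp only: poly_line_restriction eval3_scale[OF hom] f)
    also have "\<dots> = c * ((z * (inverse z - r)) * (z * (inverse z - s)) * (z * (inverse z - t)))"
      by (simp add: power3_eq_cube)
    also have "\<dots> = c * ((1 - r * z) * (1 - s * z) * (1 - t * z))"
      using that by (simp add: right_diff_distrib mult.commute)
    finally show ?thesis by (simp add: algebra_simps)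
  qed
  \<comment> \<open>The division by \<open>z\<close> excludes 0, yet 0 is the point of interest.
    Agreement at infinitely many \<open>z\<close> makes the two polynomials equal, hence also at
    0.\<close>
  then have "- {0} \<subseteq> {z. poly (?g - ?h) z = 0}" by auto
  then have "infinite {z. poly (?g - ?h) z = 0}"
    using infinite_UNIV_char_0 finite_subset[of "- {0}"] by (metis finite_compl finite.emptyI finite.insertI)
  then have "?g = ?h"
    using poly_roots_finite[of "?g - ?h"] by auto
  then have "eval3 F y = c"
    using poly_line_restriction[of F y x 0] by simp
  then show ?thesis
    using f[of 0] by simp
qed

lemma span_singleton_scale:
  fixes x :: "'a::field ^ 3"
  assumes "k \<noteq> 0"
  shows "vec.span {k *s x} = vec.span {x}"
proof (cases "x = 0")
  case False
  then have "vec.span {x} = vec.span {k *s x}"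
    using assms by (subst span_singleton_eq_iff) auto
  then show ?thesis by simp
qed simp

lemma span_comb_normalize:
  fixes x y :: "'a::field ^ 3"
  assumes "\<alpha> \<noteq> 0"
  shows "vec.span {\<alpha> *s x + \<beta> *s y} = vec.span {x + (\<beta> / \<alpha>) *s y}"
proof -
  have "\<alpha> *s x + \<beta> *s y = \<alpha> *s (x + (\<beta> / \<alpha>) *s y)"
    using assms by (simp add: vec.scale_right_distrib)
  then show ?thesis
    using assms by (metis span_singleton_scale)
qed

text \<open>Clearing denominators in \<open>eval3_ratio\<close> gives a relation that survives when
  the third point is a vertex: then each side of the equation contains a factor 0, either the
  coefficient or the value of \<open>F\<close>.\<close>

lemma carnot_side:
  fixes F :: "'a::field_char_0 poly3"
  assumes hom: "homogeneous 3 F" and xy: "lin_indep2 x y"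
    and M: "intersection_points F (vec.span {x, y}) {#vec.span {\<alpha>1 *s x + \<beta>1 *s y},
        vec.span {\<alpha>2 *s x + \<beta>2 *s y}, vec.span {\<alpha>3 *s x + \<beta>3 *s y}#}"
    and nz: "\<alpha>1 \<noteq> 0" "\<beta>1 \<noteq> 0" "\<alpha>2 \<noteq> 0" "\<beta>2 \<noteq> 0" "\<alpha>3 \<noteq> 0 \<or> \<beta>3 \<noteq> 0"
  shows "eval3 F x = 0 \<longleftrightarrow> \<beta>3 = 0" "eval3 F y = 0 \<longleftrightarrow> \<alpha>3 = 0"
    and "eval3 F x * (\<alpha>1 * \<alpha>2 * \<alpha>3) = - (eval3 F y * (\<beta>1 * \<beta>2 * \<beta>3))"
proof -
  note eq = span_singleton_comb_eq_iff[OF xy]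
  have yx: "lin_indep2 y x" using xy by (simp add: lin_indep2_commute)
  have "vec.span {x} = vec.span {\<alpha> *s x + \<beta> *s y} \<longleftrightarrow> \<beta> = 0" if "\<alpha> \<noteq> 0 \<or> \<beta> \<noteq> 0" for \<alpha> \<beta>
    using eq[of 1 0 \<alpha> \<beta>] that by simp
  moreover have "vec.span {y} = vec.span {\<alpha> *s x + \<beta> *s y} \<longleftrightarrow> \<alpha> = 0" if "\<alpha> \<noteq> 0 \<or> \<beta> \<noteq> 0" for \<alpha> \<beta>
    using eq[of 0 1 \<alpha> \<beta>] that by auto
  ultimately have mem: "vec.span {x} \<in># {#vec.span {\<alpha>1 *s x + \<beta>1 *s y},
        vec.span {\<alpha>2 *s x + \<beta>2 *s y}, vec.span {\<alpha>3 *s x + \<beta>3 *s y}#} \<longleftrightarrow> \<beta>3 = 0"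
     "vec.span {y} \<in># {#vec.span {\<alpha>1 *s x + \<beta>1 *s y},
        vec.span {\<alpha>2 *s x + \<beta>2 *s y}, vec.span {\<alpha>3 *s x + \<beta>3 *s y}#} \<longleftrightarrow> \<alpha>3 = 0"
    using nz by simp_all
  show x: "eval3 F x = 0 \<longleftrightarrow> \<beta>3 = 0"
    using eval3_eq_0_iff[OF M xy, of "\<beta>1 / \<alpha>1"] nz mem by (simp add: span_comb_normalize)
  have M': "intersection_points F (vec.span {y, x}) {#vec.span {\<alpha>1 *s x + \<beta>1 *s y},
        vec.span {\<alpha>2 *s x + \<beta>2 *s y}, vec.span {\<alpha>3 *s x + \<beta>3 *s y}#}"
    using M by (simp add: insert_commute)
  \<comment> \<open>For the vanishing at \<open>y\<close> the roles of \<open>x\<close> and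
    \<open>y\<close> are exchanged; the first point again supplies the required member with a finite
    parameter.\<close>
  have "vec.span {y + (\<alpha>1 / \<beta>1) *s x} = vec.span {\<alpha>1 *s x + \<beta>1 *s y}"
    using nz span_comb_normalize[of \<beta>1 y \<alpha>1 x] by (simp add: add.commute)
  then show y: "eval3 F y = 0 \<longleftrightarrow> \<alpha>3 = 0"
    using eval3_eq_0_iff[OF M' yx, of "\<alpha>1 / \<beta>1"] mem by simp
  show "eval3 F x * (\<alpha>1 * \<alpha>2 * \<alpha>3) = - (eval3 F y * (\<beta>1 * \<beta>2 * \<beta>3))"
  proof (cases "\<alpha>3 = 0 \<or> \<beta>3 = 0")
    case True
    then show ?thesis using x y nz(5) by auto
  next
    case False
    then have "eval3 F x = - (\<beta>1 / \<alpha>1 * (\<beta>2 / \<alpha>2) * (\<beta>3 / \<alpha>3) * eval3 F y)"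
      using M nz by (intro eval3_ratio[OF hom xy]) (simp add: span_comb_normalize)
    then show ?thesis
      using nz False by (simp add: field_simps)
  qed
qed

text \<open>If \<open>F\<close> vanishes at a vertex, then both sides of the conclusion contain a factor \<open>0\<close>.\<close>

lemma carnot_cubic:
  fixes F :: "'a::field_char_0 poly3"
  assumes hom: "homogeneous 3 F" and "lin_indep2 u v" "lin_indep2 v w" "lin_indep2 w u"
    and "intersection_points F (vec.span {u, v}) {#vec.span {\<alpha>1 *s u + \<beta>1 *s v},
        vec.span {\<alpha>2 *s u + \<beta>2 *s v}, vec.span {\<alpha>7 *s u + \<beta>7 *s v}#}"
    and "intersection_points F (vec.span {v, w}) {#vec.span {\<alpha>3 *s v + \<beta>3 *s w},
        vec.span {\<alpha>4 *s v + \<beta>4 *s w}, vec.span {\<alpha>8 *s v + \<beta>8 *s w}#}"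
    and "intersection_points F (vec.span {w, u}) {#vec.span {\<alpha>5 *s w + \<beta>5 *s u},
        vec.span {\<alpha>6 *s w + \<beta>6 *s u}, vec.span {\<alpha>9 *s w + \<beta>9 *s u}#}"
    and nz: "\<alpha>1 \<noteq> 0" "\<beta>1 \<noteq> 0" "\<alpha>2 \<noteq> 0" "\<beta>2 \<noteq> 0" "\<alpha>7 \<noteq> 0 \<or> \<beta>7 \<noteq> 0"
      "\<alpha>3 \<noteq> 0" "\<beta>3 \<noteq> 0" "\<alpha>4 \<noteq> 0" "\<beta>4 \<noteq> 0" "\<alpha>8 \<noteq> 0 \<or> \<beta>8 \<noteq> 0"
      "\<alpha>5 \<noteq> 0" "\<beta>5 \<noteq> 0" "\<alpha>6 \<noteq> 0" "\<beta>6 \<noteq> 0" "\<alpha>9 \<noteq> 0 \<or> \<beta>9 \<noteq> 0"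
  shows "(\<alpha>1 * \<alpha>2 * \<alpha>7) * (\<alpha>3 * \<alpha>4 * \<alpha>8) * (\<alpha>5 * \<alpha>6 * \<alpha>9) =
    - ((\<beta>1 * \<beta>2 * \<beta>7) * (\<beta>3 * \<beta>4 * \<beta>8) * (\<beta>5 * \<beta>6 * \<beta>9))"
proof -
  note a = carnot_side[OF hom assms(2,5) nz(1-5)]
    and b = carnot_side[OF hom assms(3,6) nz(6-10)]
    and c = carnot_side[OF hom assms(4,7) nz(11-15)]
  show ?thesis
  proof (cases "eval3 F u = 0 \<or> eval3 F v = 0 \<or> eval3 F w = 0")
    case True
    then show ?thesis using a(1,2) b(1,2) c(1,2) by auto
  next
    case False
    let ?U = "eval3 F u" and ?V = "eval3 F v" and ?W = "eval3 F w"
    \<comment> \<open>The three side relations are multiplied. Going around the triangle, each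
      vertex value appears once on either side and cancels, and the three signs multiply to one
      minus.\<close>
    have "?U * ?V * ?W * ((\<alpha>1 * \<alpha>2 * \<alpha>7) * (\<alpha>3 * \<alpha>4 * \<alpha>8) * (\<alpha>5 * \<alpha>6 * \<alpha>9))
        = (?U * (\<alpha>1 * \<alpha>2 * \<alpha>7)) * (?V * (\<alpha>3 * \<alpha>4 * \<alpha>8)) * (?W * (\<alpha>5 * \<alpha>6 * \<alpha>9))"
      by (simp add: mult_ac)
    also have "\<dots> = ?U * ?V * ?W * - ((\<beta>1 * \<beta>2 * \<beta>7) * (\<beta>3 * \<beta>4 * \<beta>8) * (\<beta>5 * \<beta>6 * \<beta>9))"
      unfolding a(3) b(3) c(3) by (simp add: mult_ac)
    finally have "?U * ?V * ?W * ((\<alpha>1 * \<alpha>2 * \<alpha>7) * (\<alpha>3 * \<alpha>4 * \<alpha>8) * (\<alpha>5 * \<alpha>6 * \<alpha>9))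
        = ?U * ?V * ?W * - ((\<beta>1 * \<beta>2 * \<beta>7) * (\<beta>3 * \<beta>4 * \<beta>8) * (\<beta>5 * \<beta>6 * \<beta>9))" .
    moreover have "?U * ?V * ?W \<noteq> 0" using False by simp
    ultimately show ?thesis by (rule mult_left_cancel[THEN iffD1, rotated])
  qed
qed

section \<open>The converse of Carnot's theorem for conics\<close>

text \<open>Summing over a common index set makes evaluation additive even when cancellation shrinks
  the set of keys of a sum.\<close>

lemma eval3_superset:
  assumes "finite S" "Poly_Mapping.keys F \<subseteq> S"
  shows "eval3 F x = (\<Sum>m\<in>S. Poly_Mapping.lookup F m * (\<Prod>i\<in>UNIV. (x $ i) ^ Poly_Mapping.lookup m i))"
  unfolding eval3_def using assms by (intro sum.mono_neutral_left) (auto simp: in_keys_iff)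

lemma eval3_add: "eval3 (F + G) x = eval3 F x + eval3 G x"
proof -
  let ?S = "Poly_Mapping.keys F \<union> Poly_Mapping.keys G"
  have "Poly_Mapping.keys (F + G) \<subseteq> ?S" by (rule Poly_Mapping.keys_add)
  then show ?thesis
    by (simp add: eval3_superset[of ?S] lookup_add distrib_right sum.distrib)
qed

lemma eval3_sum: "eval3 (\<Sum>i\<in>I. F i) x = (\<Sum>i\<in>I. eval3 (F i) x)"
  by (induction I rule: infinite_finite_induct) (simp_all add: eval3_add, simp_all add: eval3_def)

lemma homogeneous_add: "homogeneous d F \<Longrightarrow> homogeneous d G \<Longrightarrow> homogeneous d (F + G)"
  using Poly_Mapping.keys_add[of F G] by (auto simp: homogeneous_def)

lemma homogeneous_sum:
  "(\<And>i. i \<in> I \<Longrightarrow> homogeneous d (F i)) \<Longrightarrow> homogeneous d (\<Sum>i\<in>I. F i)"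
proof (induction I rule: infinite_finite_induct)
  case (insert i I)
  then show ?case by (simp add: homogeneous_add)
qed (simp_all add: homogeneous_def)

text \<open>The entries of \<open>c\<close> at \<open>(i, j)\<close> and \<open>(j, i)\<close> are
  added at the same exponent vector and may cancel, so \<open>Q\<close> being nonzero has to be
  shown separately.\<close>

lemma quadratic_form_poly3:
  fixes c :: "3 \<Rightarrow> 3 \<Rightarrow> 'a::field"
  obtains Q where "homogeneous 2 Q" "\<And>x. eval3 Q x = (\<Sum>i\<in>UNIV. \<Sum>j\<in>UNIV. c i j * (x $ i * x $ j))"
proof
  let ?m = "\<lambda>i j :: 3. Poly_Mapping.single i 1 + Poly_Mapping.single j (1::nat)"
  let ?Q = "\<Sum>i\<in>UNIV. \<Sum>j\<in>UNIV. Poly_Mapping.single (?m i j) (c i j)"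
  have "homogeneous 2 (Poly_Mapping.single (?m i j) (c i j))" for i j
    by (auto simp: homogeneous_def lookup_add sum.distrib lookup_single when_def)
  then show "homogeneous 2 ?Q"
    by (intro homogeneous_sum)
  have "eval3 (Poly_Mapping.single (?m i j) (c i j)) x = c i j * (x $ i * x $ j)" for i j x
  proof -
    have "(\<Prod>k\<in>UNIV. x $ k ^ Poly_Mapping.lookup (Poly_Mapping.single i (1::nat)) k) = x $ i" for i
    proof -
      have "(\<Prod>k\<in>UNIV. x $ k ^ Poly_Mapping.lookup (Poly_Mapping.single i (1::nat)) k)
          = (\<Prod>k\<in>UNIV. if k = i then x $ k else 1)"
        by (intro prod.cong) (auto simp: lookup_single when_def)
      then show ?thesis by simp
    qed
    then show ?thesis
      by (subst eval3_superset[of "{?m i j}"]) (simp_all add: lookup_add power_add prod.distrib)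
  qed
  then show "eval3 ?Q x = (\<Sum>i\<in>UNIV. \<Sum>j\<in>UNIV. c i j * (x $ i * x $ j))" for x
    by (simp add: eval3_sum)
qed

section \<open>Coordinates with respect to a basis of three vectors\<close>

definition lin_indep3 :: "'a::field ^ 3 \<Rightarrow> 'a ^ 3 \<Rightarrow> 'a ^ 3 \<Rightarrow> bool" where
  "lin_indep3 x y z \<longleftrightarrow>
    (\<forall>\<alpha> \<beta> \<gamma>. \<alpha> *s x + \<beta> *s y + \<gamma> *s z = 0 \<longrightarrow> \<alpha> = 0 \<and> \<beta> = 0 \<and> \<gamma> = 0)"

lemma lin_indep3D:
  assumes "lin_indep3 x y z" "\<alpha> *s x + \<beta> *s y + \<gamma> *s z = 0"
  shows "\<alpha> = 0" "\<beta> = 0" "\<gamma> = 0"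
  using assms by (auto simp: lin_indep3_def)

lemma lin_indep3_rotate:
  assumes "lin_indep3 x y z"
  shows "lin_indep3 y z x"
  unfolding lin_indep3_def
proof (intro allI impI)
  fix \<alpha> \<beta> \<gamma>
  assume "\<alpha> *s y + \<beta> *s z + \<gamma> *s x = 0"
  then have "\<gamma> *s x + \<alpha> *s y + \<beta> *s z = 0"
    by (simp add: add.commute add.left_commute)
  then show "\<alpha> = 0 \<and> \<beta> = 0 \<and> \<gamma> = 0"
    using lin_indep3D[OF assms] by blast
qed

lemma lin_indep3_imp_lin_indep2:
  assumes "lin_indep3 x y z"
  shows "lin_indep2 x y"
  using lin_indep3D[OF assms, of _ _ 0] by (simp add: lin_indep2_def)

text \<open>The dual basis: \<open>f\<close>, \<open>g\<close>, \<open>h\<close> are the rows of the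
  inverse of the matrix with columns \<open>u\<close>, \<open>v\<close>, \<open>w\<close>.\<close>

lemma lin_indep3_coordinates:
  fixes u v w :: "'a::field ^ 3"
  assumes "lin_indep3 u v w"
  obtains f g h where
    "\<And>\<alpha> \<beta> \<gamma>. (\<Sum>i\<in>UNIV. f i * (\<alpha> *s u + \<beta> *s v + \<gamma> *s w) $ i) = \<alpha>"
    "\<And>\<alpha> \<beta> \<gamma>. (\<Sum>i\<in>UNIV. g i * (\<alpha> *s u + \<beta> *s v + \<gamma> *s w) $ i) = \<beta>"
    "\<And>\<alpha> \<beta> \<gamma>. (\<Sum>i\<in>UNIV. h i * (\<alpha> *s u + \<beta> *s v + \<gamma> *s w) $ i) = \<gamma>"
proof -
  define M :: "'a ^ 3 ^ 3" where "M = transpose (vector [u, v, w])"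
  have M: "M *v z = z $ 1 *s u + z $ 2 *s v + z $ 3 *s w" for z
    by (simp add: M_def matrix_vector_mult_def transpose_def vec_eq_iff sum_3 mult.commute)
  have "z = 0" if "M *v z = 0" for z
    using lin_indep3D[OF assms that[unfolded M]] by (simp add: vec_eq_iff forall_3)
  then have "\<exists>N. N ** M = mat 1"
    unfolding matrix_left_invertible_ker by simp
  then obtain N where N: "N ** M = mat 1" ..
  have "N *v (\<alpha> *s u + \<beta> *s v + \<gamma> *s w) = vector [\<alpha>, \<beta>, \<gamma>]" for \<alpha> \<beta> \<gamma>
  proof -
    have "M *v vector [\<alpha>, \<beta>, \<gamma>] = \<alpha> *s u + \<beta> *s v + \<gamma> *s w"
      by (simp add: M)
    then show ?thesis
      by (metis N matrix_vector_mul_assoc matrix_vector_mul_lid)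
  qed
  then have *: "(\<Sum>i\<in>UNIV. N $ k $ i * (\<alpha> *s u + \<beta> *s v + \<gamma> *s w) $ i) = vector [\<alpha>, \<beta>, \<gamma>] $ k" for \<alpha> \<beta> \<gamma> k
    by (subst (asm) vec_eq_iff) (simp only: matrix_vector_mult_def vec_lambda_beta)
  show ?thesis
    by (rule that[of "\<lambda>i. N $ 1 $ i" "\<lambda>i. N $ 2 $ i" "\<lambda>i. N $ 3 $ i"]) (simp_all only: * vector_3)
qed

text \<open>A homogeneous linear system in \<open>k1\<close>, \<open>k2\<close>, \<open>k3\<close>
  with determinant \<open>a1 * a2 * a3 - b1 * b2 * b3\<close>, which is 0 by assumption.\<close>

lemma cyclic_system_solvable:
  fixes a1 a2 a3 b1 b2 b3 :: "'a::field"
  assumes "a1 * a2 * a3 = b1 * b2 * b3"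
  obtains k1 k2 k3 where "k1 \<noteq> 0 \<or> k2 \<noteq> 0 \<or> k3 \<noteq> 0"
    "k1 * a1 = k2 * b1" "k2 * a2 = k3 * b2" "k3 * a3 = k1 * b3"
proof -
  \<comment> \<open>The first three cases use the cofactors of one row of the system. If all these
    vanish, then both coefficients of some unknown are 0, and that unknown can be set to 1 and the
    others to 0.\<close>
  consider "b1 * b2 \<noteq> 0 \<or> a1 * b2 \<noteq> 0 \<or> a1 * a2 \<noteq> 0"
    | "b2 * b3 \<noteq> 0 \<or> a2 * b3 \<noteq> 0 \<or> a2 * a3 \<noteq> 0"
    | "b3 * b1 \<noteq> 0 \<or> a3 * b1 \<noteq> 0 \<or> a3 * a1 \<noteq> 0"
    | "a1 = 0" "b3 = 0" | "a2 = 0" "b1 = 0" | "a3 = 0" "b2 = 0"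
    unfolding mult_eq_0_iff by blast
  then show ?thesis
  proof cases
    case 1
    then show ?thesis
      using assms by (intro that[of "b1 * b2" "a1 * b2" "a1 * a2"]) (simp_all add: mult_ac)
  next
    case 2
    then show ?thesis
      using assms by (intro that[of "a2 * a3" "b2 * b3" "a2 * b3"]) (auto simp add: mult_ac)
  next
    case 3
    then show ?thesis
      using assms by (intro that[of "a3 * b1" "a3 * a1" "b3 * b1"]) (auto simp add: mult_ac)
  next
    case 4
    then show ?thesis by (intro that[of 1 0 0]) simp_all
  next
    case 5
    then show ?thesis by (intro that[of 0 1 0]) simp_all
  next
    case 6
    then show ?thesis by (intro that[of 0 0 1]) simp_all
  qed
qed

text \<open>On each side the form should be a multiple, by \<open>k1\<close>, \<open>k2\<close> or
  \<open>k3\<close>, of the product of two linear forms vanishing at the two given points. A square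
  term at a vertex is seen from two sides, and the cyclic system says that the two prescriptions
  agree.\<close>

lemma carnot_conic:
  fixes u v w :: "'a::field ^ 3"
  assumes ind: "lin_indep3 u v w"
    and nz: "a1 \<noteq> 0 \<or> b1 \<noteq> 0" "a2 \<noteq> 0 \<or> b2 \<noteq> 0" "a3 \<noteq> 0 \<or> b3 \<noteq> 0"
      "a4 \<noteq> 0 \<or> b4 \<noteq> 0" "a5 \<noteq> 0 \<or> b5 \<noteq> 0" "a6 \<noteq> 0 \<or> b6 \<noteq> 0"
    and prod: "(a1 * a2) * (a3 * a4) * (a5 * a6) = (b1 * b2) * (b3 * b4) * (b5 * b6)"
  obtains C where "is_conic C"
    "vec.span {a1 *s u + b1 *s v} \<in> C" "vec.span {a2 *s u + b2 *s v} \<in> C"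
    "vec.span {a3 *s v + b3 *s w} \<in> C" "vec.span {a4 *s v + b4 *s w} \<in> C"
    "vec.span {a5 *s w + b5 *s u} \<in> C" "vec.span {a6 *s w + b6 *s u} \<in> C"
proof -
  obtain f g h where coords:
    "\<And>\<alpha> \<beta> \<gamma>. (\<Sum>i\<in>UNIV. f i * (\<alpha> *s u + \<beta> *s v + \<gamma> *s w) $ i) = \<alpha>"
    "\<And>\<alpha> \<beta> \<gamma>. (\<Sum>i\<in>UNIV. g i * (\<alpha> *s u + \<beta> *s v + \<gamma> *s w) $ i) = \<beta>"
    "\<And>\<alpha> \<beta> \<gamma>. (\<Sum>i\<in>UNIV. h i * (\<alpha> *s u + \<beta> *s v + \<gamma> *s w) $ i) = \<gamma>"
    by (rule lin_indep3_coordinates[OF ind]) (rule that)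
  \<comment> \<open>The factors on the right are rotated because each equation of the system
    compares one side with the next.\<close>
  have "(a1 * a2) * (a3 * a4) * (a5 * a6) = (b3 * b4) * (b5 * b6) * (b1 * b2)"
    using prod by (simp add: mult_ac)
  then obtain k1 k2 k3 where k: "k1 \<noteq> 0 \<or> k2 \<noteq> 0 \<or> k3 \<noteq> 0"
    "k1 * (a1 * a2) = k2 * (b3 * b4)" "k2 * (a3 * a4) = k3 * (b5 * b6)" "k3 * (a5 * a6) = k1 * (b1 * b2)"
    by (rule cyclic_system_solvable) (rule that)
  \<comment> \<open>The mixed coefficients: each is visible on one side only and is therefore read
    off from the product on that side.\<close>
  define p where "p = - (k1 * (b1 * a2 + a1 * b2))"
  define q where "q = - (k2 * (b3 * a4 + a3 * b4))"
  define r where "r = - (k3 * (b5 * a6 + a5 * b6))"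
  obtain Q where Q: "homogeneous 2 Q" and Q_eval:
    "\<And>x. eval3 Q x = (\<Sum>i\<in>UNIV. \<Sum>j\<in>UNIV. (k1 * (b1 * b2) * (f i * f j) + k2 * (b3 * b4) * (g i * g j)
      + k3 * (b5 * b6) * (h i * h j) + p * (f i * g j) + q * (g i * h j) + r * (h i * f j)) * (x $ i * x $ j))"
    by (rule quadratic_form_poly3) (rule that)
  define X where "X x = (\<Sum>i\<in>UNIV. f i * x $ i)" for x :: "'a ^ 3"
  define Y where "Y x = (\<Sum>i\<in>UNIV. g i * x $ i)" for x :: "'a ^ 3"
  define Z where "Z x = (\<Sum>i\<in>UNIV. h i * x $ i)" for x :: "'a ^ 3"
  have summand: "(\<Sum>i\<in>UNIV. \<Sum>j\<in>UNIV. c * (l i * m j) * (x $ i * x $ j)) =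
      c * ((\<Sum>i\<in>UNIV. l i * x $ i) * (\<Sum>j\<in>UNIV. m j * x $ j))" for c l m and x :: "'a ^ 3"
    unfolding sum_product by (simp add: sum_distrib_left mult_ac)
  have "eval3 Q x = k1 * (b1 * b2) * (X x * X x) + k2 * (b3 * b4) * (Y x * Y x)
      + k3 * (b5 * b6) * (Z x * Z x) + p * (X x * Y x) + q * (Y x * Z x) + r * (Z x * X x)" for x
    unfolding Q_eval distrib_right sum.distrib summand X_def Y_def Z_def ..
  note Q_eval = this
  have eval: "eval3 Q (\<alpha> *s u + \<beta> *s v + \<gamma> *s w) =
      k1 * (b1 * b2) * (\<alpha> * \<alpha>) + k2 * (b3 * b4) * (\<beta> * \<beta>) + k3 * (b5 * b6) * (\<gamma> * \<gamma>)
      + p * (\<alpha> * \<beta>) + q * (\<beta> * \<gamma>) + r * (\<gamma> * \<alpha>)" for \<alpha> \<beta> \<gamma>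
    unfolding Q_eval by (simp only: X_def Y_def Z_def coords)
  have uv: "eval3 Q (\<alpha> *s u + \<beta> *s v) = k1 * ((b1 * \<alpha> - a1 * \<beta>) * (b2 * \<alpha> - a2 * \<beta>))" for \<alpha> \<beta>
    using eval[of \<alpha> \<beta> 0] by (simp add: p_def k(2)[symmetric]) (simp add: algebra_simps)
  have vw: "eval3 Q (\<alpha> *s v + \<beta> *s w) = k2 * ((b3 * \<alpha> - a3 * \<beta>) * (b4 * \<alpha> - a4 * \<beta>))" for \<alpha> \<beta>
    using eval[of 0 \<alpha> \<beta>] by (simp add: q_def flip: k(3)) (simp add: algebra_simps)
  have wu: "eval3 Q (\<alpha> *s w + \<beta> *s u) = k3 * ((b5 * \<alpha> - a5 * \<beta>) * (b6 * \<alpha> - a6 * \<beta>))" for \<alpha> \<beta>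
    using eval[of \<beta> 0 \<alpha>] by (simp add: r_def add.commute[of "\<beta> *s u"] flip: k(4)) (simp add: algebra_simps)
  \<comment> \<open>A product of two nonzero linear forms is not identically zero, so a side with
    nonzero multiplier carries a nonzero restriction.\<close>
  have nonroot: "\<exists>\<alpha> \<beta>. (b * \<alpha> - a * \<beta>) * (b' * \<alpha> - a' * \<beta>) \<noteq> 0"
    if ab: "a \<noteq> 0 \<or> b \<noteq> 0" "a' \<noteq> 0 \<or> b' \<noteq> 0" for a b a' b' :: 'a
  proof -
    consider "b * b' \<noteq> 0" | "a * a' \<noteq> 0" | "b = 0" "a' = 0" | "b' = 0" "a = 0"
      using ab unfolding mult_eq_0_iff by blast
    then show ?thesis
    proof cases
      case 1
      then show ?thesis by (intro exI[of _ 1] exI[of _ 0]) simp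
    next
      case 2
      then show ?thesis by (intro exI[of _ 0] exI[of _ 1]) simp
    next
      case 3
      then show ?thesis using ab by (intro exI[of _ 1]) simp
    next
      case 4
      then show ?thesis using ab by (intro exI[of _ 1]) simp
    qed
  qed
  have "Q \<noteq> 0"
  proof
    assume "Q = 0"
    then have 0: "eval3 Q x = 0" for x by (simp add: eval3_def)
    have "k1 = 0"
      using nonroot[OF nz(1,2)] uv[symmetric] unfolding 0 mult_eq_0_iff by blast
    moreover have "k2 = 0"
      using nonroot[OF nz(3,4)] vw[symmetric] unfolding 0 mult_eq_0_iff by blast
    moreover have "k3 = 0"
      using nonroot[OF nz(5,6)] wu[symmetric] unfolding 0 mult_eq_0_iff by blast
    ultimately show False using k(1) by blast
  qed
  then have conic: "is_conic (zero_set Q)"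
    using Q by (auto simp: is_conic_def)
  have mem: "vec.span {x} \<in> zero_set Q" if "x \<noteq> 0" "eval3 Q x = 0" for x
    using that proj_point_span[OF that(1)] by (auto simp: zero_set_def vec.span_singleton eval3_scale[OF Q])
  have "lin_indep2 u v" "lin_indep2 v w" "lin_indep2 w u"
    using ind lin_indep3_rotate[of u v w] lin_indep3_rotate[of v w u]
    by (simp_all add: lin_indep3_imp_lin_indep2)
  then have nonzero: "\<alpha> *s u + \<beta> *s v \<noteq> 0" "\<alpha> *s v + \<beta> *s w \<noteq> 0" "\<alpha> *s w + \<beta> *s u \<noteq> 0"
    if "\<alpha> \<noteq> 0 \<or> \<beta> \<noteq> 0" for \<alpha> \<beta>
    using that by (auto simp: lin_indep2D)
  show ?thesis
    by (intro that[OF conic] mem nonzero nz) (simp_all add: uv vw wu mult.commute)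
qed

section \<open>The Pascal mapping\<close>

text \<open>The defining condition is invariant under rescaling either coefficient pair, so the
  point \<open>Q\<close> is unique although its coefficients are not.\<close>

lemma characteristic_map_eq:
  assumes "lin_indep2 s t" "\<alpha> \<noteq> 0" "\<beta> \<noteq> 0"
  shows "characteristic_map s t (vec.span {\<alpha> *s s + \<beta> *s t}) = vec.span {\<beta> *s s + \<alpha> *s t}"
  unfolding characteristic_map_def
proof (rule the_equality)
  show "\<exists>\<alpha>' \<beta>' \<alpha>'' \<beta>''. \<alpha>' * \<beta>' \<noteq> 0 \<and>
      vec.span {\<alpha> *s s + \<beta> *s t} = vec.span {\<alpha>' *s s + \<beta>' *s t} \<and>
      vec.span {\<beta> *s s + \<alpha> *s t} = vec.span {\<alpha>'' *s s + \<beta>'' *s t} \<and> \<beta>' * \<beta>'' / (\<alpha>' * \<alpha>'') = 1"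
    using assms by - (rule exI[of _ \<alpha>], rule exI[of _ \<beta>], rule exI[of _ \<beta>], rule exI[of _ \<alpha>], simp)
next
  fix Q
  assume "\<exists>\<alpha>' \<beta>' \<alpha>'' \<beta>''. \<alpha>' * \<beta>' \<noteq> 0 \<and>
      vec.span {\<alpha> *s s + \<beta> *s t} = vec.span {\<alpha>' *s s + \<beta>' *s t} \<and>
      Q = vec.span {\<alpha>'' *s s + \<beta>'' *s t} \<and> \<beta>' * \<beta>'' / (\<alpha>' * \<alpha>'') = 1"
  then obtain \<alpha>' \<beta>' \<alpha>'' \<beta>'' where *: "\<alpha>' * \<beta>' \<noteq> 0"
      "vec.span {\<alpha> *s s + \<beta> *s t} = vec.span {\<alpha>' *s s + \<beta>' *s t}"
      "Q = vec.span {\<alpha>'' *s s + \<beta>'' *s t}" "\<beta>' * \<beta>'' / (\<alpha>' * \<alpha>'') = 1"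
    by blast
  have nz: "\<alpha>'' \<noteq> 0" "\<beta>'' \<noteq> 0" "\<alpha>' \<noteq> 0" "\<beta>' \<noteq> 0"
    using *(1,4) by auto
  have "\<alpha> * \<beta>' = \<beta> * \<alpha>'"
    using *(2) nz assms by (simp add: span_singleton_comb_eq_iff)
  moreover have "\<beta>' * \<beta>'' = \<alpha>' * \<alpha>''"
    using *(4) nz by (simp add: field_simps)
  ultimately have "(\<alpha>' * \<beta>') * (\<alpha>'' * \<alpha>) = (\<alpha>' * \<beta>') * (\<beta>'' * \<beta>)"
    by algebra
  then have "\<alpha>'' * \<alpha> = \<beta>'' * \<beta>"
    using nz by simp
  then show "Q = vec.span {\<beta> *s s + \<alpha> *s t}"
    unfolding *(3) using nz assms by (subst span_singleton_comb_eq_iff) auto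
qed

lemma join_span: "join (vec.span {x}) (vec.span {y}) = vec.span {x, y}"
proof -
  have "vec.span {x} \<subseteq> vec.span {x, y}" "vec.span {y} \<subseteq> vec.span {x, y}"
    by (simp_all add: vec.span_mono)
  then show ?thesis
    unfolding join_def
    by (intro antisym vec.span_minimal) (auto intro!: vec.span_base)
qed

lemma join_on_side:
  assumes "lin_indep2 x y"
    and "\<alpha> \<noteq> 0 \<or> \<beta> \<noteq> 0" "\<gamma> \<noteq> 0 \<or> \<delta> \<noteq> 0"
    and "vec.span {\<alpha> *s x + \<beta> *s y} \<noteq> vec.span {\<gamma> *s x + \<delta> *s y}"
  shows "join (vec.span {\<alpha> *s x + \<beta> *s y}) (vec.span {\<gamma> *s x + \<delta> *s y}) = vec.span {x, y}"
  using assms by (simp add: span_singleton_comb_eq_iff join_span span_pair_comb)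

text \<open>A point of the transversal lies on the side exactly when its \<open>z\<close>-coordinate
  vanishes. This forces the weights of the two spanning points into the ratio
  \<open>\<gamma>\<close> to \<open>-\<beta>\<close>.\<close>

lemma meet_side_transversal:
  assumes xyz: "lin_indep3 x y z" and nz: "\<beta> \<noteq> 0" "\<gamma> \<noteq> 0"
  shows "meet (vec.span {x, y}) (join (vec.span {\<alpha> *s y + \<beta> *s z}) (vec.span {\<gamma> *s z + \<delta> *s x}))
    = vec.span {(- (\<beta> * \<delta>)) *s x + (\<alpha> * \<gamma>) *s y}" (is "?L = vec.span {?q}")
proof (intro antisym subsetI)
  fix p assume "p \<in> ?L"
  then obtain a b s t where p: "p = a *s x + b *s y"
      "p = s *s (\<alpha> *s y + \<beta> *s z) + t *s (\<gamma> *s z + \<delta> *s x)"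
    unfolding meet_def join_span span_pair_eq by blast
  have "(a - t * \<delta>) *s x + (b - s * \<alpha>) *s y + (- (s * \<beta> + t * \<gamma>)) *s z
      = (a *s x + b *s y) - (s *s (\<alpha> *s y + \<beta> *s z) + t *s (\<gamma> *s z + \<delta> *s x))"
    by (simp add: vec_eq_iff algebra_simps)
  also have "\<dots> = 0" using p by simp
  finally have eqs: "a = t * \<delta>" "b = s * \<alpha>" "s * \<beta> + t * \<gamma> = 0"
    using lin_indep3D[OF xyz] by (metis eq_iff_diff_eq_0 neg_equal_0_iff_equal)+
  have "t * \<gamma> = - (s * \<beta>)"
    using eqs(3) by (metis eq_neg_iff_add_eq_0 add.commute)
  then have "t = - (s * \<beta>) / \<gamma>"
    using nz by (simp only: nonzero_eq_divide_eq not_False_eq_True)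
  then have "t * \<delta> = (s / \<gamma>) * (- (\<beta> * \<delta>))" "s * \<alpha> = (s / \<gamma>) * (\<alpha> * \<gamma>)"
    using nz by simp_all
  then have "p = (s / \<gamma>) *s ?q"
    unfolding p(1) eqs(1,2) by (simp only: vec.scale_right_distrib vec.scale_scale)
  then show "p \<in> vec.span {?q}"
    unfolding vec.span_singleton by blast
next
  fix p assume "p \<in> vec.span {?q}"
  then obtain k where k: "p = k *s ?q"
    by (auto simp: vec.span_singleton)
  have "p = (k * - (\<beta> * \<delta>)) *s x + (k * (\<alpha> * \<gamma>)) *s y"
    using k by (simp add: vec_eq_iff algebra_simps)
  moreover have "p = (k * \<gamma>) *s (\<alpha> *s y + \<beta> *s z) + (- (k * \<beta>)) *s (\<gamma> *s z + \<delta> *s x)"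
    using k by (simp add: vec_eq_iff algebra_simps)
  ultimately show "p \<in> ?L"
    unfolding meet_def join_span span_pair_eq by blast
qed

section \<open>The triangle formed by the three lines and the points on its sides\<close>

lemma triangle_side:
  fixes x y :: "'a::field ^ 3"
  assumes "proj_line l" "proj_line m" "x \<in> l" "y \<in> l" "y \<in> m" "x \<notin> m" "y \<noteq> 0"
  shows "lin_indep2 x y" "l = vec.span {x, y}"
proof -
  have m: "vec.subspace m" using assms by (simp add: proj_line_def)
  show "lin_indep2 x y"
    unfolding lin_indep2_def
  proof (intro allI impI)
    fix \<alpha> \<beta> assume 0: "\<alpha> *s x + \<beta> *s y = 0"
    have "\<alpha> = 0"
    proof (rule ccontr)
      assume "\<alpha> \<noteq> 0"
      then have "x = (- (\<beta> / \<alpha>)) *s y"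
        using 0 by (simp add: vec_eq_iff field_simps eq_neg_iff_add_eq_0)
      then show False
        using assms m by (metis vec.subspace_scale)
    qed
    then show "\<alpha> = 0 \<and> \<beta> = 0" using 0 assms by auto
  qed
  then show "l = vec.span {x, y}"
    using assms by (intro proj_line_eq_span) auto
qed

text \<open>A vertex lying on the opposite side would be common to all three lines. Hence adjacent
  vertices are independent and the third one lies outside their span.\<close>

lemma triangle_basis:
  fixes u v w :: "'a::field ^ 3"
  assumes lines: "proj_line a" "proj_line b" "proj_line c"
    and noconc: "\<not> (\<exists>P. proj_point P \<and> P \<subseteq> a \<and> P \<subseteq> b \<and> P \<subseteq> c)"
    and vertices: "vec.span {u} = meet a c" "vec.span {v} = meet a b" "vec.span {w} = meet b c"
  shows "lin_indep3 u v w" "a = vec.span {u, v}" "b = vec.span {v, w}" "c = vec.span {w, u}"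
proof -
  have sub: "vec.subspace a" "vec.subspace b" "vec.subspace c"
    using lines by (auto simp: proj_line_def)
  have none: "x = 0" if "x \<in> a" "x \<in> b" "x \<in> c" for x
  proof (rule ccontr)
    assume "x \<noteq> 0"
    then have "proj_point (vec.span {x})" by (rule proj_point_span)
    moreover have "vec.span {x} \<subseteq> a" "vec.span {x} \<subseteq> b" "vec.span {x} \<subseteq> c"
      using that sub by (simp_all add: vec.span_minimal)
    ultimately show False using noconc by blast
  qed
  have mem: "u \<in> a" "u \<in> c" "v \<in> a" "v \<in> b" "w \<in> b" "w \<in> c"
    using vertices vec.span_base[of u "{u}"] vec.span_base[of v "{v}"] vec.span_base[of w "{w}"]
    by (auto simp: meet_def)
  \<comment> \<open>A zero representative would make the intersection of the two lines trivial,
    which the dimension count rules out.\<close>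
  have "x \<noteq> 0" if lm: "proj_line l" "proj_line m" "vec.span {x} = meet l m" for x :: "'a ^ 3" and l m
  proof
    assume "x = 0"
    then have "l \<inter> m = {0}" using lm(3) by (simp add: meet_def)
    moreover obtain y where "y \<noteq> 0" "y \<in> l" "y \<in> m"
      using proj_lines_meet[OF lm(1,2)] .
    ultimately show False by blast
  qed
  from this[OF lines(1,3) vertices(1)] this[OF lines(1,2) vertices(2)] this[OF lines(2,3) vertices(3)]
  have nz: "u \<noteq> 0" "v \<noteq> 0" "w \<noteq> 0" .
  have notin: "u \<notin> b" "v \<notin> c" "w \<notin> a"
    using none nz mem by blast+
  note a = triangle_side[OF lines(1,2) mem(1,3,4) notin(1) nz(2)]
    and b = triangle_side[OF lines(2,3) mem(4,5,6) notin(2) nz(3)]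
    and c = triangle_side[OF lines(3,1) mem(6,2,1) notin(3) nz(1)]
  show "a = vec.span {u, v}" "b = vec.span {v, w}" "c = vec.span {w, u}"
    using a(2) b(2) c(2) .
  note uv = a(1)
  show "lin_indep3 u v w"
    unfolding lin_indep3_def
  proof (intro allI impI)
    fix \<alpha> \<beta> \<gamma> assume 0: "\<alpha> *s u + \<beta> *s v + \<gamma> *s w = 0"
    have "\<gamma> = 0"
    proof (rule ccontr)
      assume "\<gamma> \<noteq> 0"
      then have "w = (- (1 / \<gamma>)) *s (\<alpha> *s u + \<beta> *s v)"
        using 0 by (simp add: vec_eq_iff field_simps eq_neg_iff_add_eq_0)
      then have "w \<in> a"
        using mem sub by (metis vec.subspace_add vec.subspace_scale)
      then show False using notin by blast
    qed
    then show "\<alpha> = 0 \<and> \<beta> = 0 \<and> \<gamma> = 0" using 0 lin_indep2D[OF uv] by simp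
  qed
qed

lemma point_on_sideE:
  fixes x y :: "'a::field ^ 3"
  assumes "proj_point P" "P \<subseteq> vec.span {x, y}"
  obtains \<alpha> \<beta> where "\<alpha> \<noteq> 0 \<or> \<beta> \<noteq> 0" "P = vec.span {\<alpha> *s x + \<beta> *s y}"
proof -
  obtain z where z: "z \<noteq> 0" "P = vec.span {z}"
    using proj_pointE[OF assms(1)] .
  then have "z \<in> vec.span {x, y}"
    using assms(2) vec.span_base[of z "{z}"] by auto
  then obtain \<alpha> \<beta> where comb: "z = \<alpha> *s x + \<beta> *s y"
    unfolding span_pair_eq by blast
  then have "\<alpha> \<noteq> 0 \<or> \<beta> \<noteq> 0"
    using z(1) by auto
  with comb z(2) show ?thesis by (simp add: that)
qed

lemma point_on_side_not_vertexE:
  fixes x y :: "'a::field ^ 3"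
  assumes "proj_point P" "P \<subseteq> vec.span {x, y}" "\<not> vec.span {x} = P" "\<not> vec.span {y} = P"
  obtains \<alpha> \<beta> where "\<alpha> \<noteq> 0" "\<beta> \<noteq> 0" "P = vec.span {\<alpha> *s x + \<beta> *s y}"
proof -
  obtain \<alpha> \<beta> where *: "\<alpha> \<noteq> 0 \<or> \<beta> \<noteq> 0" "P = vec.span {\<alpha> *s x + \<beta> *s y}"
    using point_on_sideE[OF assms(1,2)] .
  moreover have "\<alpha> \<noteq> 0"
  proof
    assume "\<alpha> = 0"
    with * have "P = vec.span {y}" by (simp add: span_singleton_scale)
    with assms(4) show False by blast
  qed
  moreover have "\<beta> \<noteq> 0"
  proof
    assume "\<beta> = 0"
    with * have "P = vec.span {x}" by (simp add: span_singleton_scale)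
    with assms(3) show False by blast
  qed
  ultimately show ?thesis using that by blast
qed

text \<open>Excludes coincidences on a side. The two orders serve because the collinearity
  hypothesis lists indices increasingly: the repeated pair comes first for 1, 2, 3 and last for 1,
  5, 6.\<close>

lemma collinear3_repeated:
  assumes "lin_indep2 x y"
  shows "collinear3 (vec.span {x}) (vec.span {x}) (vec.span {y})"
    and "collinear3 (vec.span {y}) (vec.span {x}) (vec.span {x})"
proof -
  have "vec.span {x} \<subseteq> vec.span {x, y}" "vec.span {y} \<subseteq> vec.span {x, y}"
    by (simp_all add: vec.span_mono)
  then show "collinear3 (vec.span {x}) (vec.span {x}) (vec.span {y})"
    and "collinear3 (vec.span {y}) (vec.span {x}) (vec.span {x})"
    using proj_line_span[OF assms] unfolding collinear3_def by blast+
qed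

text \<open>Each of the two points has a coordinate that the other lacks, along \<open>x\<close> and
  along \<open>z\<close> respectively.\<close>

lemma lin_indep2_adjacent_sides:
  assumes "lin_indep3 x y z" "\<alpha> \<noteq> 0" "\<delta> \<noteq> 0"
  shows "lin_indep2 (\<alpha> *s x + \<beta> *s y) (\<gamma> *s y + \<delta> *s z)"
  unfolding lin_indep2_def
proof (intro allI impI)
  fix s t assume "s *s (\<alpha> *s x + \<beta> *s y) + t *s (\<gamma> *s y + \<delta> *s z) = 0"
  then have "(s * \<alpha>) *s x + (s * \<beta> + t * \<gamma>) *s y + (t * \<delta>) *s z = 0"
    by (simp add: vec_eq_iff algebra_simps)
  from lin_indep3D[OF assms(1) this] show "s = 0 \<and> t = 0" using assms by simp
qed

text \<open>A field of characteristic 0 covers the real and the complex case at once. The cyclic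
  orientation \<open>(u, v)\<close>, \<open>(v, w)\<close>, \<open>(w, u)\<close> lets every side
  lemma be reused after a rotation.\<close>

lemma pascal_points_on_conic:
  fixes F :: "'a::field_char_0 poly3" and p :: "nat \<Rightarrow> ('a ^ 3) set"
  assumes hom: "homogeneous 3 F"
    and lines: "proj_line a" "proj_line b" "proj_line c"
    and noconc: "\<not> (\<exists>P. proj_point P \<and> P \<subseteq> a \<and> P \<subseteq> b \<and> P \<subseteq> c)"
    and a: "intersection_points F a {#p 1, p 2, p 7#}"
    and b: "intersection_points F b {#p 3, p 4, p 8#}"
    and c: "intersection_points F c {#p 5, p 6, p 9#}"
    and nocoll: "\<And>i j k. 1 \<le> i \<and> i < j \<and> j < k \<and> k \<le> 6 \<Longrightarrow> \<not> collinear3 (p i) (p j) (p k)"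
    and vertices: "vec.span {u} = meet a c" "vec.span {v} = meet a b" "vec.span {w} = meet b c"
  shows "\<exists>C. is_conic C \<and> pascal_map u v w p \<union> {p 7, p 8, p 9} \<subseteq> C"
proof -
  note triangle = triangle_basis[OF lines noconc vertices]
  note uvw = triangle(1)
  note vwu = lin_indep3_rotate[OF uvw] note wuv = lin_indep3_rotate[OF vwu]
  note uv = lin_indep3_imp_lin_indep2[OF uvw] and vw = lin_indep3_imp_lin_indep2[OF vwu]
    and wu = lin_indep3_imp_lin_indep2[OF wuv]
  have on_a: "proj_point (p 1)" "proj_point (p 2)" "proj_point (p 7)" "p 1 \<subseteq> a" "p 2 \<subseteq> a" "p 7 \<subseteq> a"
    and on_b: "proj_point (p 3)" "proj_point (p 4)" "proj_point (p 8)" "p 3 \<subseteq> b" "p 4 \<subseteq> b" "p 8 \<subseteq> b"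
    and on_c: "proj_point (p 5)" "proj_point (p 6)" "proj_point (p 9)" "p 5 \<subseteq> c" "p 6 \<subseteq> c" "p 9 \<subseteq> c"
    using a b c by (simp_all add: intersection_points_def)
  have vertex: "vec.span {u} \<subseteq> a" "vec.span {u} \<subseteq> c" "vec.span {v} \<subseteq> a" "vec.span {v} \<subseteq> b"
      "vec.span {w} \<subseteq> b" "vec.span {w} \<subseteq> c"
    using vertices by (auto simp: meet_def)
  have no_three: "\<not> (p i \<subseteq> l \<and> p j \<subseteq> l \<and> p k \<subseteq> l)"
    if "proj_line l" "1 \<le> i" "i < j" "j < k" "k \<le> 6" for i j k l
    using nocoll[of i j k] that unfolding collinear3_def by blast
  \<comment> \<open>A chosen point at a vertex also lies on the adjacent side, where it would be
    collinear with the two points chosen there.\<close>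
  have not_vertex: "\<not> vec.span {u} = p 1" "\<not> vec.span {v} = p 1" "\<not> vec.span {u} = p 2" "\<not> vec.span {v} = p 2"
      "\<not> vec.span {v} = p 3" "\<not> vec.span {w} = p 3" "\<not> vec.span {v} = p 4" "\<not> vec.span {w} = p 4"
      "\<not> vec.span {w} = p 5" "\<not> vec.span {u} = p 5" "\<not> vec.span {w} = p 6" "\<not> vec.span {u} = p 6"
    using no_three[OF lines(3), of 1 5 6] no_three[OF lines(2), of 1 3 4]
      no_three[OF lines(3), of 2 5 6] no_three[OF lines(2), of 2 3 4]
      no_three[OF lines(1), of 1 2 3] no_three[OF lines(3), of 3 5 6]
      no_three[OF lines(1), of 1 2 4] no_three[OF lines(3), of 4 5 6]
      no_three[OF lines(2), of 3 4 5] no_three[OF lines(1), of 1 2 5]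
      no_three[OF lines(2), of 3 4 6] no_three[OF lines(1), of 1 2 6]
      on_a on_b on_c vertex
    by auto
  obtain \<alpha>1 \<beta>1 where p1: "\<alpha>1 \<noteq> 0" "\<beta>1 \<noteq> 0" "p 1 = vec.span {\<alpha>1 *s u + \<beta>1 *s v}"
    using point_on_side_not_vertexE[OF on_a(1) on_a(4)[unfolded triangle(2)] not_vertex(1,2)] .
  obtain \<alpha>2 \<beta>2 where p2: "\<alpha>2 \<noteq> 0" "\<beta>2 \<noteq> 0" "p 2 = vec.span {\<alpha>2 *s u + \<beta>2 *s v}"
    using point_on_side_not_vertexE[OF on_a(2) on_a(5)[unfolded triangle(2)] not_vertex(3,4)] .
  obtain \<alpha>3 \<beta>3 where p3: "\<alpha>3 \<noteq> 0" "\<beta>3 \<noteq> 0" "p 3 = vec.span {\<alpha>3 *s v + \<beta>3 *s w}"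
    using point_on_side_not_vertexE[OF on_b(1) on_b(4)[unfolded triangle(3)] not_vertex(5,6)] .
  obtain \<alpha>4 \<beta>4 where p4: "\<alpha>4 \<noteq> 0" "\<beta>4 \<noteq> 0" "p 4 = vec.span {\<alpha>4 *s v + \<beta>4 *s w}"
    using point_on_side_not_vertexE[OF on_b(2) on_b(5)[unfolded triangle(3)] not_vertex(7,8)] .
  obtain \<alpha>5 \<beta>5 where p5: "\<alpha>5 \<noteq> 0" "\<beta>5 \<noteq> 0" "p 5 = vec.span {\<alpha>5 *s w + \<beta>5 *s u}"
    using point_on_side_not_vertexE[OF on_c(1) on_c(4)[unfolded triangle(4)] not_vertex(9,10)] .
  obtain \<alpha>6 \<beta>6 where p6: "\<alpha>6 \<noteq> 0" "\<beta>6 \<noteq> 0" "p 6 = vec.span {\<alpha>6 *s w + \<beta>6 *s u}"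
    using point_on_side_not_vertexE[OF on_c(2) on_c(5)[unfolded triangle(4)] not_vertex(11,12)] .
  \<comment> \<open>The remaining points may be vertices, so only one of the two coefficients is
    known to be nonzero.\<close>
  obtain \<alpha>7 \<beta>7 where p7: "\<alpha>7 \<noteq> 0 \<or> \<beta>7 \<noteq> 0" "p 7 = vec.span {\<alpha>7 *s u + \<beta>7 *s v}"
    using point_on_sideE[OF on_a(3) on_a(6)[unfolded triangle(2)]] .
  obtain \<alpha>8 \<beta>8 where p8: "\<alpha>8 \<noteq> 0 \<or> \<beta>8 \<noteq> 0" "p 8 = vec.span {\<alpha>8 *s v + \<beta>8 *s w}"
    using point_on_sideE[OF on_b(3) on_b(6)[unfolded triangle(3)]] .
  obtain \<alpha>9 \<beta>9 where p9: "\<alpha>9 \<noteq> 0 \<or> \<beta>9 \<noteq> 0" "p 9 = vec.span {\<alpha>9 *s w + \<beta>9 *s u}"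
    using point_on_sideE[OF on_c(3) on_c(6)[unfolded triangle(4)]] .
  have "p 1 \<noteq> p 2"
    using nocoll[of 1 2 3] p1 p2 p3 collinear3_repeated(1)[OF lin_indep2_adjacent_sides[OF uvw p2(1) p3(2)]]
    by auto
  then have a': "join (p 1) (p 2) = vec.span {u, v}"
    unfolding p1(3) p2(3) using p1 p2 by (intro join_on_side[OF uv]) auto
  have "p 3 \<noteq> p 4"
    using nocoll[of 3 4 5] p3 p4 p5 collinear3_repeated(1)[OF lin_indep2_adjacent_sides[OF vwu p4(1) p5(2)]]
    by auto
  then have b': "join (p 3) (p 4) = vec.span {v, w}"
    unfolding p3(3) p4(3) using p3 p4 by (intro join_on_side[OF vw]) auto
  have "p 5 \<noteq> p 6"
    using nocoll[of 1 5 6] p5 p6 p1 collinear3_repeated(2)[OF lin_indep2_adjacent_sides[OF wuv p6(1) p1(2)]]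
    by auto
  then have c': "join (p 5) (p 6) = vec.span {w, u}"
    unfolding p5(3) p6(3) using p5 p6 by (intro join_on_side[OF wu]) auto
  have "meet (join (p 1) (p 2)) (join (p 4) (p 5)) = vec.span {(- (\<beta>4 * \<beta>5)) *s u + (\<alpha>4 * \<alpha>5) *s v}"
    unfolding a' p4(3) p5(3) by (rule meet_side_transversal[OF uvw p4(2) p5(1)])
  then have q1: "characteristic_map u v (meet (join (p 1) (p 2)) (join (p 4) (p 5)))
      = vec.span {(\<alpha>4 * \<alpha>5) *s u + (- (\<beta>4 * \<beta>5)) *s v}"
    using p4 p5 characteristic_map_eq[OF uv, of "- (\<beta>4 * \<beta>5)" "\<alpha>4 * \<alpha>5"] by simp
  \<comment> \<open>The side is put first to fit \<open>meet_side_transversal\<close>;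
    \<open>pascal_map\<close> has the two lines in the other order.\<close>
  have "meet (join (p 5) (p 6)) (join (p 2) (p 3)) = vec.span {(- (\<beta>2 * \<beta>3)) *s w + (\<alpha>2 * \<alpha>3) *s u}"
    unfolding c' p2(3) p3(3) by (rule meet_side_transversal[OF wuv p2(2) p3(1)])
  then have q2: "characteristic_map w u (meet (join (p 2) (p 3)) (join (p 5) (p 6)))
      = vec.span {(\<alpha>2 * \<alpha>3) *s w + (- (\<beta>2 * \<beta>3)) *s u}"
    using p2 p3 characteristic_map_eq[OF wu, of "- (\<beta>2 * \<beta>3)" "\<alpha>2 * \<alpha>3"] by (simp add: meet_def Int_commute)
  have "meet (join (p 3) (p 4)) (join (p 6) (p 1)) = vec.span {(- (\<beta>6 * \<beta>1)) *s v + (\<alpha>6 * \<alpha>1) *s w}"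
    unfolding b' p6(3) p1(3) by (rule meet_side_transversal[OF vwu p6(2) p1(1)])
  then have q3: "characteristic_map v w (meet (join (p 3) (p 4)) (join (p 6) (p 1)))
      = vec.span {(\<alpha>6 * \<alpha>1) *s v + (- (\<beta>6 * \<beta>1)) *s w}"
    using p6 p1 characteristic_map_eq[OF vw, of "- (\<beta>6 * \<beta>1)" "\<alpha>6 * \<alpha>1"] by simp
  have "(\<alpha>1 * \<alpha>2 * \<alpha>7) * (\<alpha>3 * \<alpha>4 * \<alpha>8) * (\<alpha>5 * \<alpha>6 * \<alpha>9)
      = - ((\<beta>1 * \<beta>2 * \<beta>7) * (\<beta>3 * \<beta>4 * \<beta>8) * (\<beta>5 * \<beta>6 * \<beta>9))"
    by (rule carnot_cubic[OF hom uv vw wu a[unfolded triangle(2) p1(3) p2(3) p7(2)]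
        b[unfolded triangle(3) p3(3) p4(3) p8(2)] c[unfolded triangle(4) p5(3) p6(3) p9(2)]
        p1(1,2) p2(1,2) p7(1) p3(1,2) p4(1,2) p8(1) p5(1,2) p6(1,2) p9(1)])
  \<comment> \<open>The factors are regrouped by the side carrying each Pascal point: indices 4, 5
    join 7 on \<open>a\<close>, indices 6, 1 join 8 on \<open>b\<close>, and indices 2, 3 join 9 on
    \<open>c\<close>.\<close>
  then have prod: "(\<alpha>4 * \<alpha>5 * \<alpha>7) * (\<alpha>6 * \<alpha>1 * \<alpha>8) * (\<alpha>2 * \<alpha>3 * \<alpha>9)
      = (- (\<beta>4 * \<beta>5) * \<beta>7) * (- (\<beta>6 * \<beta>1) * \<beta>8) * (- (\<beta>2 * \<beta>3) * \<beta>9)"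
    by (simp add: mult_ac)
  have nz: "\<alpha>4 * \<alpha>5 \<noteq> 0 \<or> - (\<beta>4 * \<beta>5) \<noteq> 0" "\<alpha>6 * \<alpha>1 \<noteq> 0 \<or> - (\<beta>6 * \<beta>1) \<noteq> 0"
      "\<alpha>2 * \<alpha>3 \<noteq> 0 \<or> - (\<beta>2 * \<beta>3) \<noteq> 0"
    using p1 p2 p3 p4 p5 p6 by simp_all
  obtain C where "is_conic C"
    "vec.span {(\<alpha>4 * \<alpha>5) *s u + (- (\<beta>4 * \<beta>5)) *s v} \<in> C" "vec.span {\<alpha>7 *s u + \<beta>7 *s v} \<in> C"
    "vec.span {(\<alpha>6 * \<alpha>1) *s v + (- (\<beta>6 * \<beta>1)) *s w} \<in> C" "vec.span {\<alpha>8 *s v + \<beta>8 *s w} \<in> C"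
    "vec.span {(\<alpha>2 * \<alpha>3) *s w + (- (\<beta>2 * \<beta>3)) *s u} \<in> C" "vec.span {\<alpha>9 *s w + \<beta>9 *s u} \<in> C"
    using carnot_conic[OF uvw nz(1) p7(1) nz(2) p8(1) nz(3) p9(1) prod] .
  then show ?thesis
    unfolding pascal_map_def Let_def q1 q2 q3 p7(2) p8(2) p9(2) by blast
qed

theorem theorem4p3:
  shows
    "(\<forall>(F :: real poly3) a b c u v w (p :: nat \<Rightarrow> (real ^ 3) set).
       F \<noteq> 0 \<and> homogeneous 3 F \<and>
       proj_line a \<and> proj_line b \<and> proj_line c \<and>
       \<not> (\<exists>P. proj_point P \<and> P \<subseteq> a \<and> P \<subseteq> b \<and> P \<subseteq> c) \<and>
       \<not> line_component a F \<and> \<not> line_component b F \<and> \<not> line_component c F \<and>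
       intersection_points F a {#p 1, p 2, p 7#} \<and>
       intersection_points F b {#p 3, p 4, p 8#} \<and>
       intersection_points F c {#p 5, p 6, p 9#} \<and>
       (\<forall>i j k. 1 \<le> i \<and> i < j \<and> j < k \<and> k \<le> 6 \<longrightarrow> \<not> collinear3 (p i) (p j) (p k)) \<and>
       vec.span {u} = meet a c \<and> vec.span {v} = meet a b \<and> vec.span {w} = meet b c \<longrightarrow>
       (\<exists>C. is_conic C \<and> pascal_map u v w p \<union> {p 7, p 8, p 9} \<subseteq> C)) \<and>
     (\<forall>(F :: complex poly3) a b c u v w (p :: nat \<Rightarrow> (complex ^ 3) set).
       F \<noteq> 0 \<and> homogeneous 3 F \<and>
       proj_line a \<and> proj_line b \<and> proj_line c \<and>
       \<not> (\<exists>P. proj_point P \<and> P \<subseteq> a \<and> P \<subseteq> b \<and> P \<subseteq> c) \<and>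
       \<not> line_component a F \<and> \<not> line_component b F \<and> \<not> line_component c F \<and>
       intersection_points F a {#p 1, p 2, p 7#} \<and>
       intersection_points F b {#p 3, p 4, p 8#} \<and>
       intersection_points F c {#p 5, p 6, p 9#} \<and>
       (\<forall>i j k. 1 \<le> i \<and> i < j \<and> j < k \<and> k \<le> 6 \<longrightarrow> \<not> collinear3 (p i) (p j) (p k)) \<and>
       vec.span {u} = meet a c \<and> vec.span {v} = meet a b \<and> vec.span {w} = meet b c \<longrightarrow>
       (\<exists>C. is_conic C \<and> pascal_map u v w p \<union> {p 7, p 8, p 9} \<subseteq> C))"
  by (intro conjI allI impI; elim conjE; rule pascal_points_on_conic) simp_all

end
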